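(* Let $S=\mathbb{K}[x_1,\dots,x_n]$ be a polynomial ring over a field $\mathbb{K}$, and let $\mathcal{C}$ be a clutter whose vertex set is a subset of $\{x_1,\dots,x_n\}$, with edge ideal $I(\mathcal{C})\subset S$. Then \[ \min\{\operatorname{depth}(S/I(\mathcal{C})),\ \operatorname{sdepth}(S/I(\mathcal{C}))\}\ge \epsilon(\mathcal{C})+n-|V(\mathcal{C}^{\mathrm{red}})|. \]
   Context: A clutter $\mathcal{C}$ consists of a finite vertex set $V(\mathcal{C})$ and a collection $E(\mathcal{C})$ of subsets of $V(\mathcal{C})$ (edges), no edge containing another. Vertices are identified with variables; the edge ideal is $I(\mathcal{C})=(\prod_{x\in e}x : e\in E(\mathcal{C}))$. Two distinct vertices are neighbors if some edge contains both. A vertex is isolated if it lies in no edge; $\mathcal{C}^{\mathrm{red}}$ is the clutter obtained by removing isolated vertices. An edge is trivial if it has exactly one vertex. A set $F\subseteq E(\mathcal{C})$ of edges is edgewise dominant if every vertex $v\in V(\mathcal{C}^{\mathrm{red}})$ that is neither contained in an edge of $F$ nor contained in a trivial edge has a neighbor contained in some edge of $F$. The index of edgewise domination is $\epsilon(\mathcal{C})=\min\{|F| : F\subseteq E(\mathcal{C}) \text{ edgewise dominant}\}$. For a finitely generated $\mathbb{Z}^n$-graded $S$-module $M$, a Stanley decomposition is a finite direct sum decomposition $M=\bigoplus_{i=1}^r u_i\mathbb{K}[Z_i]$ of $\mathbb{K}$-vector spaces, with $u_i\in M$ homogeneous, $Z_i\subseteq\{x_1,\dots,x_n\}$, and $u_i\mathbb{K}[Z_i]$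 the $\mathbb{K}$-span of $u_iv$ for monomials $v\in\mathbb{K}[Z_i]$ (required to be a free $\mathbb{K}[Z_i]$-module); its Stanley depth is $\min_i|Z_i|$, and $\operatorname{sdepth}(M)$ is the maximum of this over all Stanley decompositions of $M$. *)

theory Defs
  imports Main "HOL-Library.Poly_Mapping" "HOL-Library.Extended_Nat"
begin

text \<open>The polynomial ring S = K[x_v : v in 'v] over a field K, with a finite
  type 'v of variables (so n = CARD('v)).  Monomials are exponent vectors
  'v =>0 nat; polynomials are finitely supported maps from monomials to K.\<close>

type_synonym ('v, 'k) mpoly = "('v \<Rightarrow>\<^sub>0 nat) \<Rightarrow>\<^sub>0 'k"

definition monomial :: "('v \<Rightarrow>\<^sub>0 nat) \<Rightarrow> ('v, 'k::field) mpoly" where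
  "monomial a = Poly_Mapping.single a 1"

inductive_set gen_ideal :: "('v, 'k::field) mpoly set \<Rightarrow> ('v, 'k) mpoly set"
  for G where
    gen_ideal_zero: "0 \<in> gen_ideal G"
  | gen_ideal_gen: "g \<in> G \<Longrightarrow> g \<in> gen_ideal G"
  | gen_ideal_add: "p \<in> gen_ideal G \<Longrightarrow> q \<in> gen_ideal G \<Longrightarrow> p + q \<in> gen_ideal G"
  | gen_ideal_mult: "p \<in> gen_ideal G \<Longrightarrow> r * p \<in> gen_ideal G"

definition clutter :: "'v set \<Rightarrow> 'v set set \<Rightarrow> bool" where
  "clutter V E \<longleftrightarrow> finite V \<and> (\<forall>e\<in>E. e \<subseteq> V) \<and>
     (\<forall>e\<in>E. \<forall>e'\<in>E. e \<noteq> e' \<longrightarrow> \<not> e \<subseteq> e')"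

definition red_vertices :: "'v set set \<Rightarrow> 'v set" where
  "red_vertices E = \<Union>E"

definition neighbors :: "'v set set \<Rightarrow> 'v \<Rightarrow> 'v \<Rightarrow> bool" where
  "neighbors E u w \<longleftrightarrow> u \<noteq> w \<and> (\<exists>e\<in>E. u \<in> e \<and> w \<in> e)"

definition edgewise_dominant :: "'v set set \<Rightarrow> 'v set set \<Rightarrow> bool" where
  "edgewise_dominant E F \<longleftrightarrow> F \<subseteq> E \<and>
     (\<forall>v\<in>red_vertices E. (\<not> (\<exists>e\<in>F. v \<in> e) \<and> \<not> (\<exists>e\<in>E. e = {v})) \<longrightarrow>
        (\<exists>w. neighbors E v w \<and> (\<exists>e\<in>F. w \<in> e)))"

definition edgewise_domination_index :: "'v set set \<Rightarrow> nat" where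
  "edgewise_domination_index E = (LEAST k. \<exists>F. edgewise_dominant E F \<and> card F = k)"

definition edge_ideal :: "'v set set \<Rightarrow> ('v, 'k::field) mpoly set" where
  "edge_ideal E = gen_ideal ((\<lambda>e. monomial (\<Sum>x\<in>e. Poly_Mapping.single x 1)) ` E)"

definition max_ideal :: "('v, 'k::field) mpoly set" where
  "max_ideal = {f. Poly_Mapping.lookup f 0 = 0}"

definition regular_seq :: "('v, 'k::field) mpoly set \<Rightarrow> ('v, 'k) mpoly list \<Rightarrow> bool" where
  "regular_seq I fs \<longleftrightarrow> set fs \<subseteq> max_ideal \<and>
     gen_ideal (I \<union> set fs) \<noteq> UNIV \<and>
     (\<forall>i<length fs. \<forall>g. fs ! i * g \<in> gen_ideal (I \<union> set (take i fs))
         \<longrightarrow> g \<in> gen_ideal (I \<union> set (take i fs)))"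

text \<open>depth(S/I) for an ideal I contained in m; the zero module has depth infinity.\<close>
definition depth_quot :: "('v, 'k::field) mpoly set \<Rightarrow> enat" where
  "depth_quot I = (if I = UNIV then \<infinity>
     else Sup {enat (length fs) | fs. regular_seq I fs})"

definition subring_poly :: "'v set \<Rightarrow> ('v, 'k::field) mpoly set" where
  "subring_poly Z = {p. \<forall>a\<in>Poly_Mapping.keys p. Poly_Mapping.keys a \<subseteq> Z}"

text \<open>A Stanley decomposition of the Z^n-graded module S/I: a list of pairs (u_i, Z_i),
  where the homogeneous element u_i is (the class of) the monomial x^{u_i}
  (a nonzero scalar factor does not change u_i K[Z_i]).  Conditions: each u_i K[Z_i]
  is a free K[Z_i]-module (multiplication by u_i is injective from K[Z_i] to S/I),
  the sum of the u_i K[Z_i] is all of S/I, and the sum is direct.\<close>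
definition stanley_decomp ::
    "('v, 'k::field) mpoly set \<Rightarrow> (('v \<Rightarrow>\<^sub>0 nat) \<times> 'v set) list \<Rightarrow> bool" where
  "stanley_decomp I D \<longleftrightarrow>
     (\<forall>i<length D. \<forall>p\<in>subring_poly (snd (D ! i)).
         monomial (fst (D ! i)) * p \<in> I \<longrightarrow> p = 0) \<and>
     (\<forall>f. \<exists>ps. length ps = length D \<and>
         (\<forall>i<length D. ps ! i \<in> subring_poly (snd (D ! i))) \<and>
         f - (\<Sum>i<length D. monomial (fst (D ! i)) * ps ! i) \<in> I) \<and>
     (\<forall>ps. length ps = length D \<longrightarrow>
         (\<forall>i<length D. ps ! i \<in> subring_poly (snd (D ! i))) \<longrightarrow>
         (\<Sum>i<length D. monomial (fst (D ! i)) * ps ! i) \<in> I \<longrightarrow>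
         (\<forall>i<length D. monomial (fst (D ! i)) * ps ! i \<in> I))"

definition stanley_depth_of :: "(('v \<Rightarrow>\<^sub>0 nat) \<times> 'v set) list \<Rightarrow> enat" where
  "stanley_depth_of D = (if D = [] then \<infinity> else enat (Min (set (map (card \<circ> snd) D))))"

definition sdepth_quot :: "('v, 'k::field) mpoly set \<Rightarrow> enat" where
  "sdepth_quot I = Sup {stanley_depth_of D | D. stanley_decomp I D}"

end

theory Submission
  imports Defs
begin

text \<open>Both invariants are bounded through the sequence
  \<open>0 \<rightarrow> S/(I:x) \<rightarrow> S/I \<rightarrow> S/(I,x) \<rightarrow> 0\<close>, applied repeatedly until only ideals generated by
  variables remain. A Stanley decomposition of the middle term is glued from those of the outer
  ones. For the depth, a sequence that is regular on both outer terms is regular on the middle one,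
  so it suffices to have one universal sequence: the elementary symmetric polynomials
  \<open>e\<^sub>1, e\<^sub>2, \<dots>\<close> restrict to a regular sequence on every quotient of \<open>S\<close> by variables, over any
  field.

  It remains to choose the variables so that every leaf keeps enough free variables. Take a vertex
  \<open>x\<close> of a nontrivial edge and treat its neighbours \<open>v\<^sub>1, v\<^sub>2, \<dots>\<close> in turn: either
  \<open>v\<^sub>1, \<dots>, v\<^sub>i\<close> are killed and \<open>v\<^sub>i\<^sub>+\<^sub>1\<close> becomes free, or all neighbours are killed and \<open>x\<close>
  becomes free. An edge through \<open>x\<close> (and \<open>v\<^sub>i\<^sub>+\<^sub>1\<close>) dominates everything killed, and one edge per
  newly isolated vertex repairs the rest, so the domination index drops by at most the number
  of vertices that become isolated.\<close>

subsection \<open>Splitting the independence complex\<close>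

text \<open>The independence complex, for an arbitrary family of sets; it is void, not
  \<open>{{}}\<close>, if \<open>{} \<in> E\<close>.\<close>

definition faces :: "'v set set \<Rightarrow> 'v set set" where
  "faces E = {a. \<not> (\<exists>e\<in>E. e \<subseteq> a)}"

text \<open>If \<open>I\<close> is the Stanley--Reisner ideal of \<open>\<Delta>\<close>, the two premises of \<open>branch\<close> concern the
  complexes of \<open>I : x\<close> and \<open>(I, x)\<close>; the star keeps \<open>x\<close> as a cone point.\<close>

inductive splits :: "nat \<Rightarrow> 'v set set \<Rightarrow> bool" for t where
  void: "splits t {}"
| simplex: "t \<le> card U \<Longrightarrow> splits t (Pow U)"
| branch: "\<lbrakk>splits t {a. insert x a \<in> \<Delta>}; splits t {a \<in> \<Delta>. x \<notin> a}\<rbrakk> \<Longrightarrow> splits t \<Delta>"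

lemma splits_mono: "splits t \<Delta> \<Longrightarrow> s \<le> t \<Longrightarrow> splits s \<Delta>"
proof (induction rule: splits.induct)
  case (branch x \<Delta>)
  then show ?case by (intro splits.branch[of s x \<Delta>])
qed (simp_all add: splits.void splits.simplex)

section \<open>The domination index under refinement of edges\<close>

lemma edgewise_dominant_card_ge:
  assumes "edgewise_dominant E F"
  shows "edgewise_domination_index E \<le> card F"
  unfolding edgewise_domination_index_def using assms by (intro Least_le) blast

lemma edgewise_domination_index_attained:
  obtains F where "edgewise_dominant E F" "card F = edgewise_domination_index E"
proof -
  have "edgewise_dominant E E"
    by (auto simp: edgewise_dominant_def red_vertices_def)
  hence "\<exists>F. edgewise_dominant E F \<and> card F = edgewise_domination_index E"
    unfolding edgewise_domination_index_def
    by (intro LeastI[where P = "\<lambda>k. \<exists>F. edgewise_dominant E F \<and> card F = k"]) blast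
  with that show thesis by blast
qed

text \<open>Lift an optimal dominant set of \<open>E'\<close> along edge inclusions, add \<open>f0\<close> to take care of
  the pivot \<open>y\<close> and of the new trivial edges, and add one edge for every other vertex that has
  become isolated.\<close>

lemma edgewise_domination_index_refine:
  fixes E E' :: "'v::finite set set"
  assumes refine: "\<And>e. e \<in> E' \<Longrightarrow> \<exists>f\<in>E. e \<subseteq> f"
    and f0: "f0 \<in> E" "y \<in> f0" and y: "y \<notin> \<Union>E'"
    and triv: "\<And>u. {u} \<in> E' \<Longrightarrow> {u} \<notin> E \<Longrightarrow> u \<in> f0 \<or> (\<exists>w\<in>f0. neighbors E u w)"
  shows "edgewise_domination_index E + card (\<Union>E') \<le> edgewise_domination_index E' + card (\<Union>E)"
proof -
  obtain F' where F': "edgewise_dominant E' F'" "card F' = edgewise_domination_index E'"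
    by (rule edgewise_domination_index_attained)
  obtain l where l: "\<And>e. e \<in> E' \<Longrightarrow> l e \<in> E \<and> e \<subseteq> l e"
    using refine by metis
  obtain g where g: "\<And>u. u \<in> \<Union>E \<Longrightarrow> g u \<in> E \<and> u \<in> g u"
  proof -
    have "\<forall>u\<in>\<Union>E. \<exists>f. f \<in> E \<and> u \<in> f" by blast
    then show ?thesis using that by metis
  qed
  have sub: "\<Union>E' \<subseteq> \<Union>E" using refine by blast
  define R where "R = \<Union>E - \<Union>E' - {y}"
  define F where "F = l ` F' \<union> {f0} \<union> g ` R"
  have F'E: "F' \<subseteq> E'" using F'(1) by (simp add: edgewise_dominant_def)
  have nb: "neighbors E u w" if "neighbors E' u w" for u w
    using that l unfolding neighbors_def by (meson subsetD)
  have lF: "\<exists>e\<in>F. w \<in> e" if "e \<in> F'" "w \<in> e" for w e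
    using that l[of e] F'E unfolding F_def by (intro bexI[of _ "l e"]) auto
  have gF: "\<exists>e\<in>F. u \<in> e" if "u \<in> R" for u
    using that g[of u] unfolding F_def R_def by (intro bexI[of _ "g u"]) auto
  have f0F: "f0 \<in> F" by (simp add: F_def)
  have "edgewise_dominant E F"
    unfolding edgewise_dominant_def red_vertices_def
  proof (intro conjI ballI impI)
    have "l ` F' \<subseteq> E" using l F'E by auto
    moreover have "g ` R \<subseteq> E" using g unfolding R_def by blast
    ultimately show "F \<subseteq> E" using f0(1) by (simp add: F_def)
  next
    fix u assume u: "u \<in> \<Union>E" and *: "\<not> (\<exists>e\<in>F. u \<in> e) \<and> \<not> (\<exists>e\<in>E. e = {u})"
    have "u \<notin> R" using * gF by blast
    moreover have "u \<noteq> y" using * f0(2) f0F by blast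
    ultimately have uE': "u \<in> \<Union>E'" using u unfolding R_def by blast
    show "\<exists>w. neighbors E u w \<and> (\<exists>e\<in>F. w \<in> e)"
    proof (cases "{u} \<in> E'")
      \<comment> \<open>Vertices in trivial edges of \<open>E'\<close> are exempt there, so
        \<open>F'\<close> says nothing about them; \<open>triv\<close> and \<open>f0\<close> step
        in.\<close>
      case True
      then show ?thesis using triv[OF True] * f0F by blast
    next
      case False
      have "\<not> (\<exists>e\<in>F'. u \<in> e)" using * lF by blast
      then obtain w where "neighbors E' u w" "\<exists>e\<in>F'. w \<in> e"
        using F'(1) False uE' unfolding edgewise_dominant_def red_vertices_def by metis
      then show ?thesis using nb lF by blast
    qed
  qed
  hence "edgewise_domination_index E \<le> card F" by (rule edgewise_dominant_card_ge)
  also have "card F \<le> card (l ` F') + card {f0} + card (g ` R)"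
    unfolding F_def by (meson card_Un_le add_le_mono order.trans le_refl)
  also have "\<dots> \<le> card F' + 1 + card R"
    by (intro add_mono card_image_le) auto
  finally have "edgewise_domination_index E \<le> card F' + 1 + card R" .
  \<comment> \<open>The lost vertices are exactly \<open>R\<close> and the pivot \<open>y\<close>,
    and \<open>f0\<close> is charged to \<open>y\<close>.\<close>
  moreover have "card R + 1 + card (\<Union>E') = card (\<Union>E)"
  proof -
    have "y \<in> \<Union>E - \<Union>E'" using f0 y by blast
    hence "card R + 1 = card (\<Union>E - \<Union>E')"
      unfolding R_def by (metis card_Suc_Diff1 finite Suc_eq_plus1)
    also have "\<dots> = card (\<Union>E) - card (\<Union>E')"
      by (rule card_Diff_subset) (auto intro: sub[THEN subsetD])
    finally show ?thesis using card_mono[OF finite sub] by linarith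
  qed
  ultimately show ?thesis using F'(2) by linarith
qed

text \<open>The families describing stars and deletions need not be antichains; keeping only the
  minimal edges restores this without changing the faces.\<close>

definition minimal_edges :: "'v set set \<Rightarrow> 'v set set" where
  "minimal_edges E = {e \<in> E. \<forall>e'\<in>E. e' \<subseteq> e \<longrightarrow> e' = e}"

lemma minimal_edges_below:
  fixes E :: "'v::finite set set"
  assumes "e \<in> E"
  obtains m where "m \<in> minimal_edges E" "m \<subseteq> e"
  using finite_has_minimal2[of E e] assms unfolding minimal_edges_def by auto

lemma faces_minimal_edges: "faces (minimal_edges E) = faces (E :: 'v::finite set set)"
proof -
  have "(\<exists>e\<in>minimal_edges E. e \<subseteq> a) \<longleftrightarrow> (\<exists>e\<in>E. e \<subseteq> a)" for a
  proof
    assume "\<exists>e\<in>E. e \<subseteq> a"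
    then obtain e where e: "e \<in> E" "e \<subseteq> a" by blast
    from e(1) obtain m where "m \<in> minimal_edges E" "m \<subseteq> e" by (rule minimal_edges_below)
    with e(2) show "\<exists>e\<in>minimal_edges E. e \<subseteq> a" by blast
  qed (auto simp: minimal_edges_def)
  then show ?thesis by (simp add: faces_def)
qed

lemma antichain_minimal_edges:
  "\<forall>e\<in>minimal_edges E. \<forall>e'\<in>minimal_edges E. e \<noteq> e' \<longrightarrow> \<not> e \<subseteq> e'"
  by (auto simp: minimal_edges_def)

lemma faces_star: "{a. insert x a \<in> faces E} = faces ((\<lambda>e. e - {x}) ` E)"
  by (auto simp: faces_def subset_insert_iff Diff_subset_conv)

lemma faces_deletion: "{a \<in> faces E. x \<notin> a} = faces (insert {x} E)"
  by (auto simp: faces_def)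

text \<open>Induction on the number of faces, a measure that is unchanged by passing to minimal
  edges and drops strictly at the end of every branching sequence.\<close>

lemma splits_faces:
  fixes E :: "'v::finite set set"
  assumes "\<forall>e\<in>E. \<forall>e'\<in>E. e \<noteq> e' \<longrightarrow> \<not> e \<subseteq> e'"
  shows "splits (edgewise_domination_index E + card (UNIV :: 'v set) - card (\<Union>E)) (faces E)"
  using assms
proof (induction "card (faces E)" arbitrary: E rule: less_induct)
  case less
  have anti: "f = g" if "f \<in> E" "g \<in> E" "f \<subseteq> g" for f g
    using less.prems that by metis
  define t where "t = edgewise_domination_index E + card (UNIV :: 'v set) - card (\<Union>E)"
  \<comment> \<open>The outer hypothesis combined with
    \<open>edgewise_domination_index_refine\<close>: \<open>G\<close> has fewer faces, refines
    \<open>E\<close> and loses the pivot \<open>y\<close>, so its bound is at least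
    \<open>t\<close>.\<close>
  have IH: "splits t (faces G)"
    if G: "faces G \<subset> faces E" "\<And>e. e \<in> G \<Longrightarrow> \<exists>f\<in>E. e \<subseteq> f"
      and f0: "f0 \<in> E" "y \<in> f0" "y \<notin> \<Union>(minimal_edges G)"
      and triv: "\<And>u. {u} \<in> G \<Longrightarrow> {u} \<notin> E \<Longrightarrow> u \<in> f0 \<or> (\<exists>w\<in>f0. neighbors E u w)"
    for G f0 y
  proof -
    let ?M = "minimal_edges G"
    have "card (faces ?M) < card (faces E)"
      using G(1) by (simp add: faces_minimal_edges psubset_card_mono)
    hence "splits (edgewise_domination_index ?M + card (UNIV :: 'v set) - card (\<Union>?M)) (faces ?M)"
      by (rule less.hyps) (rule antichain_minimal_edges)
    moreover have "edgewise_domination_index E + card (\<Union>?M)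
        \<le> edgewise_domination_index ?M + card (\<Union>E)"
      by (rule edgewise_domination_index_refine[OF _ f0])
        (use G(2) triv in \<open>auto simp: minimal_edges_def\<close>)
    hence "t \<le> edgewise_domination_index ?M + card (UNIV :: 'v set) - card (\<Union>?M)"
      unfolding t_def by linarith
    ultimately show ?thesis by (simp add: faces_minimal_edges splits_mono)
  qed
  consider "{} \<in> E" | "\<And>e. e \<in> E \<Longrightarrow> \<exists>u. e = {u}"
    | e where "e \<in> E" "{} \<notin> E" "\<nexists>u. e = {u}"
    by blast
  then have "splits t (faces E)"
  proof cases
    case 1
    hence "faces E = {}" by (auto simp: faces_def)
    then show ?thesis by (simp add: splits.void)
  next
    case 2
    have "faces E = Pow (- \<Union>E)"
    proof -
      have "(\<exists>e\<in>E. e \<subseteq> a) \<longleftrightarrow> \<not> a \<subseteq> - \<Union>E" for a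
        using 2 by fastforce
      then show ?thesis by (auto simp: faces_def)
    qed
    \<comment> \<open>Every vertex lying in an edge is exempt, so the index is 0 and
      \<open>t\<close> is the number of vertices outside \<open>\<Union>E\<close>.\<close>
    moreover have "edgewise_dominant E {}"
      using 2 by (fastforce simp: edgewise_dominant_def red_vertices_def)
    hence "edgewise_domination_index E = 0"
      using edgewise_dominant_card_ge by fastforce
    ultimately show ?thesis
      by (simp add: t_def splits.simplex Compl_eq_Diff_UNIV card_Diff_subset)
  next
    case (3 e)
    then obtain x where x: "x \<in> e" by (metis ex_in_conv)
    obtain v0 where v0: "v0 \<in> e" "v0 \<noteq> x" using 3 x by blast
    define N where "N = {v. neighbors E x v}"
    have edge: "\<exists>f\<in>E. x \<in> f \<and> v \<in> f" if "v \<in> N" for v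
      using that by (auto simp: N_def neighbors_def)
    have v0N: "v0 \<in> N" using 3 x v0 by (auto simp: N_def neighbors_def)
    have xN: "x \<notin> N" by (auto simp: N_def neighbors_def)
    \<comment> \<open>A trivial edge inside an edge through \<open>x\<close> would violate the
      antichain property; this is what makes \<open>{v0}\<close> a face of \<open>E\<close>.\<close>
    have ntriv: "{v} \<notin> E" if vN: "v \<in> N" for v
    proof
      assume v: "{v} \<in> E"
      obtain f where f: "f \<in> E" "x \<in> f" "v \<in> f" using edge[OF vN] by blast
      hence "{v} = f" using anti[OF v, of f] by simp
      with f xN vN show False by blast
    qed
    \<comment> \<open>\<open>A\<close> collects the neighbours already killed, as singleton edges;
      the induction counts those left, and the claim is wanted for \<open>A = {}\<close>.\<close>
    have key: "splits t (faces (E \<union> (\<lambda>v. {v}) ` A))" if "A \<subseteq> N" for A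
      using that
    proof (induction "card (N - A)" arbitrary: A rule: less_induct)
      case (less A)
      let ?G = "E \<union> (\<lambda>v. {v}) ` A"
      show ?case
      proof (cases "A = N")
        case True
        \<comment> \<open>Every edge through \<open>x\<close> contains a killed neighbour and is not
          minimal, so \<open>x\<close> is the pivot; \<open>e\<close> contains \<open>x\<close>, a
          neighbour of all killed vertices.\<close>
        show ?thesis
        proof (rule IH[of _ e x])
          show "faces ?G \<subset> faces E"
          proof
            show "faces ?G \<subseteq> faces E" by (auto simp: faces_def)
            have "{v0} \<in> faces E" using 3(2) ntriv[OF v0N]
              by (auto simp: faces_def subset_singleton_iff)
            moreover have "{v0} \<notin> faces ?G" using v0N True by (auto simp: faces_def)
            ultimately show "faces ?G \<noteq> faces E" by blast
          qed
          show "x \<notin> \<Union>(minimal_edges ?G)"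
          proof
            assume "x \<in> \<Union>(minimal_edges ?G)"
            then obtain f where f: "f \<in> minimal_edges ?G" "x \<in> f" by blast
            hence fE: "f \<in> E" using xN True by (auto simp: minimal_edges_def)
            have "f \<noteq> {x}" using anti[OF fE 3(1)] x v0 by blast
            then obtain w where w: "w \<in> f" "w \<noteq> x" using f(2) by blast
            hence "w \<in> N" using f(2) fE by (auto simp: N_def neighbors_def)
            hence "{w} \<in> ?G" using True by blast
            hence "{w} = f" using f(1) w by (auto simp: minimal_edges_def)
            then show False using w f(2) by blast
          qed
          show "\<exists>f\<in>E. g \<subseteq> f" if "g \<in> ?G" for g
            using that edge less.prems by blast
          show "u \<in> e \<or> (\<exists>w\<in>e. neighbors E u w)" if "{u} \<in> ?G" "{u} \<notin> E" for u
          proof -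
            have "u \<in> N" using that less.prems by blast
            hence "neighbors E u x" by (auto simp: N_def neighbors_def)
            then show ?thesis using x by blast
          qed
        qed (use 3 x in auto)
      next
        case False
        then obtain v where v: "v \<in> N" "v \<notin> A" using less.prems by blast
        \<comment> \<open>\<open>f0\<close> serves twice: \<open>x\<close> dominates the killed
          vertices, and \<open>v\<close> those whose edge shrinks to a singleton.\<close>
        then obtain f0 where f0: "f0 \<in> E" "x \<in> f0" "v \<in> f0" using edge by blast
        let ?H = "(\<lambda>f. f - {v}) ` ?G"
        have "card (N - insert v A) < card (N - A)"
          using v by (intro psubset_card_mono) auto
        hence "splits t (faces (E \<union> (\<lambda>v. {v}) ` insert v A))"
          by (rule less.hyps) (use v less.prems in auto)
        hence del: "splits t {a \<in> faces ?G. v \<notin> a}"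
          by (simp add: faces_deletion)
        have "splits t (faces ?H)"
        proof (rule IH[of _ f0 v])
          show "faces ?H \<subset> faces E"
          proof
            show "faces ?H \<subseteq> faces E" by (auto simp: faces_def)
            \<comment> \<open>\<open>f0 - {v}\<close> is the face that disappears: by the antichain
              property no edge fits inside it, yet it is a member of \<open>?H\<close>.\<close>
            have "\<not> f \<subseteq> f0 - {v}" if "f \<in> E" for f
              using anti[OF that f0(1)] f0(3) by blast
            hence "f0 - {v} \<in> faces E" by (simp add: faces_def)
            moreover have "f0 - {v} \<notin> faces ?H" using f0 by (auto simp: faces_def)
            ultimately show "faces ?H \<noteq> faces E" by blast
          qed
          show "v \<notin> \<Union>(minimal_edges ?H)" by (auto simp: minimal_edges_def)
          show "\<exists>f\<in>E. g \<subseteq> f" if "g \<in> ?H" for g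
            using that edge less.prems by blast
          show "u \<in> f0 \<or> (\<exists>w\<in>f0. neighbors E u w)" if u: "{u} \<in> ?H" "{u} \<notin> E" for u
          proof -
            obtain h where h: "h \<in> ?G" "{u} = h - {v}" using u(1) by blast
            show ?thesis
            proof (cases "h \<in> E")
              case True
              hence "v \<in> h" using h(2) u(2) by (metis Diff_empty Diff_insert0)
              hence "neighbors E u v" using True h(2) by (auto simp: neighbors_def)
              then show ?thesis using f0(3) by blast
            next
              case False
              then obtain w where w: "w \<in> A" "h = {w}" using h(1) by blast
              hence "u = w" using h(2) by blast
              hence "neighbors E u x" using w(1) less.prems by (auto simp: N_def neighbors_def)
              then show ?thesis using f0(2) by blast
            qed
          qed
        qed (use f0 in auto)
        hence "splits t {a. insert v a \<in> faces ?G}" by (simp only: faces_star)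
        then show ?thesis using del by (rule splits.branch)
      qed
    qed
    show ?thesis using key[of "{}"] by simp
  qed
  then show ?case by (simp only: t_def)
qed

subsection \<open>Weakly regular sequences\<close>

lemma gen_ideal_uminus: "p \<in> gen_ideal G \<Longrightarrow> - p \<in> gen_ideal G"
  using gen_ideal_mult[of p G "- 1"] by simp

lemma gen_ideal_diff: "p \<in> gen_ideal G \<Longrightarrow> q \<in> gen_ideal G \<Longrightarrow> p - q \<in> gen_ideal G"
  using gen_ideal_add[of p G "- q"] gen_ideal_uminus by auto

lemma gen_ideal_mult_right: "p \<in> gen_ideal G \<Longrightarrow> p * r \<in> gen_ideal G"
  using gen_ideal_mult[of p G r] by (simp add: mult.commute)

lemma gen_ideal_sum: "(\<And>i. i \<in> A \<Longrightarrow> f i \<in> gen_ideal G) \<Longrightarrow> sum f A \<in> gen_ideal G"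
  by (induction A rule: infinite_finite_induct) (auto intro: gen_ideal.intros)

lemma gen_ideal_subset: "A \<subseteq> gen_ideal B \<Longrightarrow> gen_ideal A \<subseteq> gen_ideal B"
proof
  fix p assume "A \<subseteq> gen_ideal B" "p \<in> gen_ideal A"
  from this(2,1) show "p \<in> gen_ideal B"
    by induction (auto intro: gen_ideal_zero gen_ideal_add gen_ideal_mult)
qed

lemma gen_ideal_mono: "A \<subseteq> B \<Longrightarrow> gen_ideal A \<subseteq> gen_ideal B"
  by (intro gen_ideal_subset) (auto intro: gen_ideal_gen)

lemma gen_ideal_Un_cong:
  assumes "gen_ideal A = gen_ideal B"
  shows "gen_ideal (A \<union> C) = gen_ideal (B \<union> C)"
proof -
  have "gen_ideal (A \<union> C) \<subseteq> gen_ideal (B \<union> C)" if "gen_ideal A = gen_ideal B"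
    for A B :: "('a, 'b) mpoly set"
  proof (rule gen_ideal_subset)
    have "A \<subseteq> gen_ideal A" by (auto intro: gen_ideal_gen)
    then show "A \<union> C \<subseteq> gen_ideal (B \<union> C)"
      using that gen_ideal_mono[of B "B \<union> C"] by (auto intro: gen_ideal_gen)
  qed
  with assms show ?thesis by blast
qed

lemma gen_ideal_insert_iff: "p \<in> gen_ideal (insert f A) \<longleftrightarrow> (\<exists>h. p - f * h \<in> gen_ideal A)"
proof
  assume "p \<in> gen_ideal (insert f A)"
  then show "\<exists>h. p - f * h \<in> gen_ideal A"
  proof induction
    case gen_ideal_zero
    show ?case by (rule exI[of _ 0]) (simp add: gen_ideal.gen_ideal_zero)
  next
    case (gen_ideal_gen g)
    show ?case
    proof (cases "g = f")
      case True
      show ?thesis by (rule exI[of _ 1]) (simp add: True gen_ideal.gen_ideal_zero)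
    next
      case False
      with gen_ideal_gen show ?thesis
        by (intro exI[of _ 0]) (simp add: gen_ideal.gen_ideal_gen)
    qed
  next
    case (gen_ideal_add p q)
    then obtain h k where "p - f * h \<in> gen_ideal A" "q - f * k \<in> gen_ideal A" by blast
    then have "(p - f * h) + (q - f * k) \<in> gen_ideal A" by (rule gen_ideal.gen_ideal_add)
    then show ?case by (intro exI[of _ "h + k"]) (simp add: algebra_simps)
  next
    case (gen_ideal_mult p r)
    then obtain h where "p - f * h \<in> gen_ideal A" by blast
    then have "r * (p - f * h) \<in> gen_ideal A" by (rule gen_ideal.gen_ideal_mult)
    then show ?case by (intro exI[of _ "r * h"]) (simp add: algebra_simps)
  qed
next
  assume "\<exists>h. p - f * h \<in> gen_ideal A"
  then obtain h where "p - f * h \<in> gen_ideal A" by blast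
  then have "p - f * h \<in> gen_ideal (insert f A)"
    using gen_ideal_mono[of A "insert f A"] by blast
  moreover have "f * h \<in> gen_ideal (insert f A)"
    by (intro gen_ideal_mult_right gen_ideal_gen) simp
  ultimately show "p \<in> gen_ideal (insert f A)"
    using gen_ideal_add by fastforce
qed

section \<open>Weak regularity along exact sequences\<close>

definition adjoin :: "(nat \<Rightarrow> ('v, 'k::field) mpoly) \<Rightarrow> ('v, 'k) mpoly set \<Rightarrow> nat \<Rightarrow> ('v, 'k) mpoly set"
  where "adjoin f I i = gen_ideal (I \<union> f ` {..<i})"

text \<open>Proper quotients are not demanded, so zero modules may occur along exact sequences;
  properness is settled once, in \<open>depth_quot_SR_ideal\<close>.\<close>

definition weakly_regular ::
    "(nat \<Rightarrow> ('v, 'k::field) mpoly) \<Rightarrow> ('v, 'k) mpoly set \<Rightarrow> nat \<Rightarrow> bool"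
  where "weakly_regular f I t \<longleftrightarrow> (\<forall>i<t. \<forall>g. f i * g \<in> adjoin f I i \<longrightarrow> g \<in> adjoin f I i)"

lemma adjoin_0: "adjoin f I 0 = gen_ideal I"
  by (simp add: adjoin_def)

lemma adjoin_Suc_iff: "p \<in> adjoin f I (Suc i) \<longleftrightarrow> (\<exists>h. p - f i * h \<in> adjoin f I i)"
  by (simp add: adjoin_def lessThan_Suc gen_ideal_insert_iff)

lemma adjoin_insert_iff: "p \<in> adjoin f (insert x I) i \<longleftrightarrow> (\<exists>h. p - x * h \<in> adjoin f I i)"
  by (simp add: adjoin_def gen_ideal_insert_iff)

lemma adjoin_subset_insert: "adjoin f I i \<subseteq> adjoin f (insert x I) i"
  unfolding adjoin_def by (intro gen_ideal_mono) auto

lemma weakly_regular_cong: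
  "gen_ideal A = gen_ideal B \<Longrightarrow> weakly_regular f A t \<longleftrightarrow> weakly_regular f B t"
  by (simp add: weakly_regular_def adjoin_def gen_ideal_Un_cong[of A B])

lemma weakly_regularD:
  "weakly_regular f I t \<Longrightarrow> i < t \<Longrightarrow> f i * g \<in> adjoin f I i \<Longrightarrow> g \<in> adjoin f I i"
  by (simp add: weakly_regular_def)

lemma weakly_regular_mono: "weakly_regular f I t \<Longrightarrow> s \<le> t \<Longrightarrow> weakly_regular f I s"
  by (simp add: weakly_regular_def)

text \<open>A sequence regular on \<open>S/(I,x)\<close> keeps multiplication by \<open>x\<close>
  from \<open>S/J\<close> to \<open>S/I\<close> injective modulo its members: the elementary form of
  a vanishing Tor.\<close>

lemma colon_adjoin:
  assumes colon: "\<And>g. x * g \<in> gen_ideal I \<longleftrightarrow> g \<in> gen_ideal J"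
    and reg: "weakly_regular f (insert x I) t" and "i \<le> t"
  shows "x * g \<in> adjoin f I i \<longleftrightarrow> g \<in> adjoin f J i"
  using \<open>i \<le> t\<close>
proof (induction i arbitrary: g)
  case 0
  then show ?case by (simp add: adjoin_0 colon)
next
  case (Suc i)
  show ?case
  proof
    assume "x * g \<in> adjoin f I (Suc i)"
    then obtain h where h: "x * g - f i * h \<in> adjoin f I i"
      unfolding adjoin_Suc_iff by blast
    have "f i * h - x * g \<in> adjoin f I i"
      using h gen_ideal_uminus[of "x * g - f i * h"] by (simp add: adjoin_def)
    \<comment> \<open>Modulo \<open>x\<close> and the earlier elements \<open>f i * h\<close>
      vanishes; regularity makes \<open>h\<close> congruent to a multiple of \<open>x\<close>, and
      then \<open>x\<close> can be cancelled.\<close>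
    hence "f i * h \<in> adjoin f (insert x I) i" unfolding adjoin_insert_iff by blast
    hence "h \<in> adjoin f (insert x I) i"
      using weakly_regularD[OF reg] Suc.prems by simp
    then obtain h' where h': "h - x * h' \<in> adjoin f I i"
      unfolding adjoin_insert_iff by blast
    have "(x * g - f i * h) + f i * (h - x * h') \<in> adjoin f I i"
      using h h' unfolding adjoin_def by (intro gen_ideal_add gen_ideal_mult)
    also have "(x * g - f i * h) + f i * (h - x * h') = x * (g - f i * h')"
      by (simp add: algebra_simps)
    finally show "g \<in> adjoin f J (Suc i)"
      using Suc unfolding adjoin_Suc_iff by auto
  next
    assume "g \<in> adjoin f J (Suc i)"
    then obtain h where "g - f i * h \<in> adjoin f J i" unfolding adjoin_Suc_iff by blast
    hence "x * (g - f i * h) \<in> adjoin f I i" using Suc by simp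
    hence "x * g - f i * (x * h) \<in> adjoin f I i" by (simp add: algebra_simps)
    then show "x * g \<in> adjoin f I (Suc i)" unfolding adjoin_Suc_iff by blast
  qed
qed

text \<open>The outer terms of \<open>0 \<rightarrow> S/(I:x) \<rightarrow> S/I \<rightarrow> S/(I,x) \<rightarrow> 0\<close> control the middle one as soon as
  the \<^emph>\<open>same\<close> sequence is regular on both; \<open>colon_adjoin\<close> says that the sequence stays exact
  modulo the elements already used.\<close>

lemma weakly_regular_exact:
  assumes colon: "\<And>g. x * g \<in> gen_ideal I \<longleftrightarrow> g \<in> gen_ideal J"
    and regx: "weakly_regular f (insert x I) t" and regJ: "weakly_regular f J t"
  shows "weakly_regular f I t"
  unfolding weakly_regular_def
proof (intro allI impI)
  fix i g assume i: "i < t" and g: "f i * g \<in> adjoin f I i"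
  hence "g \<in> adjoin f (insert x I) i"
    using weakly_regularD[OF regx i] adjoin_subset_insert[of f I i x] by blast
  then obtain h where h: "g - x * h \<in> adjoin f I i" unfolding adjoin_insert_iff by blast
  have "f i * g - f i * (g - x * h) \<in> adjoin f I i"
    using g h unfolding adjoin_def by (rule gen_ideal_diff[OF _ gen_ideal_mult])
  \<comment> \<open>Injectivity of multiplication by \<open>x\<close> moves this to
    \<open>J\<close>, where regularity removes \<open>f i\<close>.\<close>
  hence "x * (f i * h) \<in> adjoin f I i" by (simp add: algebra_simps)
  hence "h \<in> adjoin f J i"
    using colon_adjoin[OF colon regx] weakly_regularD[OF regJ i] i by simp
  hence "x * h \<in> adjoin f I i"
    using colon_adjoin[OF colon regx] i by simp
  then show "g \<in> adjoin f I i"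
    using h gen_ideal_add[of "g - x * h" _ "x * h"] by (simp add: adjoin_def)
qed

subsection \<open>Stanley--Reisner ideals\<close>

lemma keys_plus_nat: "Poly_Mapping.keys (a + b) = Poly_Mapping.keys a \<union> Poly_Mapping.keys b"
  for a b :: "'v \<Rightarrow>\<^sub>0 nat"
  by (auto simp: in_keys_iff lookup_add)

lemma lookup_monomial_times: "Poly_Mapping.lookup (monomial u * p) (u + b) = Poly_Mapping.lookup p b"
  by (simp add: monomial_def lookup_mult lookup_single when_mult)

lemma keys_monomial_times: "Poly_Mapping.keys (monomial u * p) = (+) u ` Poly_Mapping.keys p"
proof
  show "Poly_Mapping.keys (monomial u * p) \<subseteq> (+) u ` Poly_Mapping.keys p"
    using keys_mult[of "monomial u" p] by (auto simp: monomial_def split: if_splits)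
  show "(+) u ` Poly_Mapping.keys p \<subseteq> Poly_Mapping.keys (monomial u * p)"
    by (auto simp: in_keys_iff lookup_monomial_times)
qed

lemma monomial_add: "monomial (a + b) = monomial a * monomial b"
  by (simp add: monomial_def mult_single)

lemma poly_mapping_sum_single:
  "p = (\<Sum>a\<in>Poly_Mapping.keys p. Poly_Mapping.single a (Poly_Mapping.lookup p a))"
  by (rule poly_mapping_eqI)
    (simp add: lookup_sum lookup_single when_def in_keys_iff sum.delta)

definition sqfree_exp :: "'v set \<Rightarrow> 'v \<Rightarrow>\<^sub>0 nat" where
  "sqfree_exp e = (\<Sum>x\<in>e. Poly_Mapping.single x 1)"

lemma lookup_sqfree_exp:
  "finite e \<Longrightarrow> Poly_Mapping.lookup (sqfree_exp e) v = (if v \<in> e then 1 else 0)"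
  by (simp add: sqfree_exp_def lookup_sum lookup_single when_def)

lemma keys_sqfree_exp: "finite e \<Longrightarrow> Poly_Mapping.keys (sqfree_exp e) = e"
  by (auto simp: in_keys_iff lookup_sqfree_exp split: if_splits)

text \<open>The Stanley-Reisner ideal, described by supports so that membership is tested term by
  term; \<open>down_closed\<close> makes it an ideal.\<close>

definition SR_ideal :: "'v set set \<Rightarrow> ('v, 'k::field) mpoly set" where
  "SR_ideal \<Delta> = {p. \<forall>a\<in>Poly_Mapping.keys p. Poly_Mapping.keys a \<notin> \<Delta>}"

definition down_closed :: "'v set set \<Rightarrow> bool" where
  "down_closed \<Delta> \<longleftrightarrow> (\<forall>a\<in>\<Delta>. \<forall>b\<subseteq>a. b \<in> \<Delta>)"

lemma down_closed_star: "down_closed \<Delta> \<Longrightarrow> down_closed {a. insert x a \<in> \<Delta>}"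
  unfolding down_closed_def by (auto dest: insert_mono)

lemma down_closed_deletion: "down_closed \<Delta> \<Longrightarrow> down_closed {a \<in> \<Delta>. x \<notin> a}"
  unfolding down_closed_def by blast

lemma down_closed_Pow: "down_closed (Pow U)"
  by (auto simp: down_closed_def)

lemma gen_ideal_SR_ideal:
  assumes "down_closed \<Delta>"
  shows "gen_ideal (SR_ideal \<Delta>) = SR_ideal \<Delta>"
proof
  show "SR_ideal \<Delta> \<subseteq> gen_ideal (SR_ideal \<Delta>)" by (auto intro: gen_ideal_gen)
  show "gen_ideal (SR_ideal \<Delta>) \<subseteq> SR_ideal \<Delta>"
  proof
    fix p assume "p \<in> gen_ideal (SR_ideal \<Delta>)"
    then show "p \<in> SR_ideal \<Delta>"
    proof induction
      case (gen_ideal_add p q)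
      then show ?case using keys_add[of p q] by (auto simp: SR_ideal_def)
    next
      case (gen_ideal_mult p r)
      show ?case unfolding SR_ideal_def
      proof (intro CollectI ballI)
        fix c assume "c \<in> Poly_Mapping.keys (r * p)"
        then obtain a b where "c = a + b" "b \<in> Poly_Mapping.keys p"
          using keys_mult[of r p] by blast
        then show "Poly_Mapping.keys c \<notin> \<Delta>"
          using gen_ideal_mult.IH assms
          unfolding SR_ideal_def down_closed_def by (auto simp: keys_plus_nat)
      qed
    qed (auto simp: SR_ideal_def)
  qed
qed

section \<open>Colon by a variable and sum with a variable\<close>

definition Var :: "'v \<Rightarrow> ('v, 'k::field) mpoly" where
  "Var x = monomial (Poly_Mapping.single x 1)"

text \<open>Multiplication by \<open>x\<close> shifts exponents without cancellation and adds
  \<open>x\<close> to every support.\<close>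

lemma Var_times_SR_ideal_iff:
  "Var x * g \<in> SR_ideal \<Delta> \<longleftrightarrow> g \<in> SR_ideal {a. insert x a \<in> \<Delta>}"
  by (simp add: Var_def SR_ideal_def keys_monomial_times keys_plus_nat)

lemma exp_split:
  assumes "x \<in> Poly_Mapping.keys a"
  obtains b :: "'v \<Rightarrow>\<^sub>0 nat" where "a = Poly_Mapping.single x 1 + b"
proof
  show "a = Poly_Mapping.single x 1 + (a - Poly_Mapping.single x 1)"
    using assms by (intro poly_mapping_eqI) (auto simp: lookup_add lookup_minus lookup_single when_def in_keys_iff)
qed

lemma monomial_ideal_memI:
  assumes "\<And>a. a \<in> Poly_Mapping.keys p \<Longrightarrow> \<exists>u b. monomial u \<in> gen_ideal G \<and> a = u + b"
  shows "p \<in> gen_ideal G"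
proof -
  have "(\<Sum>a\<in>Poly_Mapping.keys p. Poly_Mapping.single a (Poly_Mapping.lookup p a)) \<in> gen_ideal G"
  proof (rule gen_ideal_sum)
    fix a assume "a \<in> Poly_Mapping.keys p"
    then obtain u b where "monomial u \<in> gen_ideal G" and a: "a = u + b" using assms by blast
    then have "monomial u * Poly_Mapping.single b (Poly_Mapping.lookup p a) \<in> gen_ideal G"
      by (intro gen_ideal_mult_right)
    then show "Poly_Mapping.single a (Poly_Mapping.lookup p a) \<in> gen_ideal G"
      by (simp add: a monomial_def mult_single)
  qed
  then show ?thesis by (metis poly_mapping_sum_single)
qed

text \<open>A monomial whose support is not in the deletion is divisible by \<open>x\<close> or
  supported on a nonface of \<open>\<Delta>\<close>.\<close>

lemma gen_ideal_insert_Var_SR_ideal: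
  assumes "down_closed \<Delta>"
  shows "gen_ideal (insert (Var x) (SR_ideal \<Delta>)) = SR_ideal {a \<in> \<Delta>. x \<notin> a}" (is "?L = ?R")
proof
  have "gen_ideal (insert (Var x) (SR_ideal \<Delta>)) \<subseteq> gen_ideal ?R"
    by (intro gen_ideal_mono) (auto simp: SR_ideal_def monomial_def Var_def)
  then show "?L \<subseteq> ?R" using gen_ideal_SR_ideal[OF down_closed_deletion[OF assms]] by blast
  show "?R \<subseteq> ?L"
  proof
    fix p :: "('a, 'b) mpoly" assume p: "p \<in> ?R"
    show "p \<in> ?L"
    proof (rule monomial_ideal_memI)
      fix a assume a: "a \<in> Poly_Mapping.keys p"
      show "\<exists>u b. monomial u \<in> ?L \<and> a = u + b"
      proof (cases "x \<in> Poly_Mapping.keys a")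
        case True
        then obtain b where "a = Poly_Mapping.single x 1 + b" by (rule exp_split)
        moreover have "monomial (Poly_Mapping.single x 1) \<in> ?L"
          by (rule gen_ideal_gen) (simp add: Var_def)
        ultimately show ?thesis by blast
      next
        case False
        hence "(monomial a :: ('a, 'b) mpoly) \<in> SR_ideal \<Delta>" using p a by (auto simp: SR_ideal_def monomial_def)
        hence "monomial a \<in> ?L" by (intro gen_ideal_gen) simp
        then show ?thesis by (metis add.right_neutral)
      qed
    qed
  qed
qed

text \<open>A monomial is divisible by an edge monomial exactly when its support contains the edge,
  and nonfaces are the supports containing some edge.\<close>

lemma edge_ideal_eq_SR_ideal:
  fixes E :: "'v::finite set set"
  shows "edge_ideal E = (SR_ideal (faces E) :: ('v, 'k::field) mpoly set)"
proof
  have dc: "down_closed (faces E)" by (auto simp: down_closed_def faces_def)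
  have "(\<lambda>e. monomial (sqfree_exp e)) ` E \<subseteq> (SR_ideal (faces E) :: ('v, 'k) mpoly set)"
  proof (rule image_subsetI)
    fix e assume "e \<in> E"
    hence "e \<notin> faces E" by (auto simp: faces_def)
    then show "monomial (sqfree_exp e) \<in> (SR_ideal (faces E) :: ('v, 'k) mpoly set)"
      by (simp add: SR_ideal_def monomial_def keys_sqfree_exp)
  qed
  then show "edge_ideal E \<subseteq> (SR_ideal (faces E) :: ('v, 'k) mpoly set)"
    unfolding edge_ideal_def sqfree_exp_def[symmetric] using gen_ideal_mono gen_ideal_SR_ideal[OF dc] by metis
  show "SR_ideal (faces E) \<subseteq> (edge_ideal E :: ('v, 'k) mpoly set)"
  proof
    fix p :: "('v, 'k) mpoly" assume p: "p \<in> SR_ideal (faces E)"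
    show "p \<in> edge_ideal E" unfolding edge_ideal_def sqfree_exp_def[symmetric]
    proof (rule monomial_ideal_memI)
      fix a assume "a \<in> Poly_Mapping.keys p"
      then obtain e where e: "e \<in> E" "e \<subseteq> Poly_Mapping.keys a"
        using p by (auto simp: SR_ideal_def faces_def)
      have "a = sqfree_exp e + (a - sqfree_exp e)"
        using e(2) by (intro poly_mapping_eqI)
          (auto simp: lookup_add lookup_minus lookup_sqfree_exp in_keys_iff Suc_le_eq)
      then show "\<exists>u b. monomial u \<in> gen_ideal ((\<lambda>e. monomial (sqfree_exp e) :: ('v, 'k) mpoly) ` E)
          \<and> a = u + b"
        using e(1) by (blast intro: gen_ideal_gen)
    qed
  qed
qed

subsection \<open>Grading and elementary symmetric polynomials\<close>

definition exp_deg :: "('v::finite \<Rightarrow>\<^sub>0 nat) \<Rightarrow> nat" where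
  "exp_deg a = (\<Sum>x\<in>UNIV. Poly_Mapping.lookup a x)"

definition hom_part :: "nat \<Rightarrow> ('v::finite, 'k::field) mpoly \<Rightarrow> ('v, 'k) mpoly" where
  "hom_part d p = Poly_Mapping.mapp (\<lambda>a c. c when exp_deg a = d) p"

lemma exp_deg_add: "exp_deg (a + b) = exp_deg a + exp_deg b"
  by (simp add: exp_deg_def lookup_add sum.distrib)

lemma exp_deg_sqfree_exp: "exp_deg (sqfree_exp e) = card e"
  by (simp add: exp_deg_def lookup_sqfree_exp sum.If_cases)

lemma lookup_hom_part:
  "Poly_Mapping.lookup (hom_part d p) a = (if exp_deg a = d then Poly_Mapping.lookup p a else 0)"
  by (auto simp: hom_part_def lookup_mapp when_def in_keys_iff)

lemma hom_part_add: "hom_part d (p + q) = hom_part d p + hom_part d q"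
  by (rule poly_mapping_eqI) (simp add: lookup_hom_part lookup_add)

lemma hom_part_diff: "hom_part d (p - q) = hom_part d p - hom_part d q"
  by (rule poly_mapping_eqI) (simp add: lookup_hom_part lookup_minus)

lemma hom_part_zero: "hom_part d 0 = 0"
  by (rule poly_mapping_eqI) (simp add: lookup_hom_part)

lemma hom_part_sum: "hom_part d (sum f A) = (\<Sum>i\<in>A. hom_part d (f i))"
  by (induction A rule: infinite_finite_induct) (auto simp: hom_part_add hom_part_zero)

lemma sum_hom_part:
  "p = (\<Sum>d\<in>exp_deg ` Poly_Mapping.keys p. hom_part d p)"
  by (rule poly_mapping_eqI) (auto simp: lookup_sum lookup_hom_part in_keys_iff)

lemma hom_part_single_times:
  "hom_part d (Poly_Mapping.single u c * p) =
    (if exp_deg u \<le> d then Poly_Mapping.single u c * hom_part (d - exp_deg u) p else 0)"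
proof (rule poly_mapping_eqI)
  fix a
  have eq: "Poly_Mapping.lookup (Poly_Mapping.single u c * q) a =
      (if \<exists>b. a = u + b then c * Poly_Mapping.lookup q (a - u) else 0)"
    for q :: "('a, 'b) mpoly"
    by (auto simp: lookup_mult lookup_single when_mult)
  show "Poly_Mapping.lookup (hom_part d (Poly_Mapping.single u c * p)) a =
    Poly_Mapping.lookup (if exp_deg u \<le> d
      then Poly_Mapping.single u c * hom_part (d - exp_deg u) p else 0) a"
    by (auto simp: lookup_hom_part eq exp_deg_add)
qed

text \<open>Multiplying by a single term only shifts degrees, so components need to be controlled on
  generators alone.\<close>

lemma hom_part_gen_ideal:
  assumes G: "\<And>g d. g \<in> G \<Longrightarrow> hom_part d g \<in> gen_ideal G" and "p \<in> gen_ideal G"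
  shows "hom_part d p \<in> gen_ideal G"
  using assms(2)
proof (induction arbitrary: d)
  case gen_ideal_zero
  then show ?case by (simp add: hom_part_zero gen_ideal.gen_ideal_zero)
next
  case (gen_ideal_gen g)
  then show ?case by (rule G)
next
  case (gen_ideal_add p q)
  then show ?case by (simp add: hom_part_add gen_ideal.gen_ideal_add)
next
  case (gen_ideal_mult p r)
  have "hom_part d (r * p) = (\<Sum>a\<in>Poly_Mapping.keys r.
      hom_part d (Poly_Mapping.single a (Poly_Mapping.lookup r a) * p))"
    by (subst poly_mapping_sum_single[of r]) (simp add: sum_distrib_right hom_part_sum)
  also have "\<dots> \<in> gen_ideal G"
    by (intro gen_ideal_sum)
      (auto simp: hom_part_single_times gen_ideal.gen_ideal_zero
        intro: gen_ideal.gen_ideal_mult gen_ideal_mult.IH)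
  finally show ?case .
qed

text \<open>If \<open>N\<close> lies in \<open>x N\<close> modulo a graded ideal, the component of
  degree \<open>d\<close> reduces to one of degree \<open>d - 1\<close>; in degree 0 a multiple of
  \<open>x\<close> has no component. \<open>N\<close> may be any set.\<close>

lemma graded_Nakayama:
  assumes hom: "\<And>d p. p \<in> gen_ideal G \<Longrightarrow> hom_part d p \<in> gen_ideal G"
    and N: "\<And>g. g \<in> N \<Longrightarrow> \<exists>g'\<in>N. g - Var x * g' \<in> gen_ideal G"
    and "g \<in> N"
  shows "g \<in> gen_ideal G"
proof -
  have deg: "exp_deg (Poly_Mapping.single x 1) = 1"
    using exp_deg_sqfree_exp[of "{x}"] by (simp add: sqfree_exp_def)
  have "hom_part d g \<in> gen_ideal G" if "g \<in> N" for d g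
    using that
  proof (induction d arbitrary: g rule: less_induct)
    case (less d)
    then obtain g' where g': "g' \<in> N" "g - Var x * g' \<in> gen_ideal G" using N by blast
    have "hom_part d (Var x * g') \<in> gen_ideal G"
      using less.IH[of "d - 1" g'] g'(1)
      by (auto simp: Var_def monomial_def hom_part_single_times deg[simplified]
          intro: gen_ideal_mult gen_ideal_zero)
    then have "hom_part d (g - Var x * g') + hom_part d (Var x * g') \<in> gen_ideal G"
      by (rule gen_ideal_add[OF hom[OF g'(2)]])
    then show ?case by (simp add: hom_part_diff)
  qed
  with \<open>g \<in> N\<close> show ?thesis
    using gen_ideal_sum[of "exp_deg ` Poly_Mapping.keys g" "\<lambda>d. hom_part d g" G]
    by (metis sum_hom_part)
qed

text \<open>The elementary symmetric polynomial of degree \<open>i + 1\<close>.\<close>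

definition esym :: "nat \<Rightarrow> ('v::finite, 'k::field) mpoly" where
  "esym i = (\<Sum>A | card A = Suc i. monomial (sqfree_exp A))"

lemma hom_part_monomial:
  "hom_part d (monomial u) = (if exp_deg u = d then monomial u else 0)"
  by (rule poly_mapping_eqI) (auto simp: lookup_hom_part monomial_def lookup_single when_def)

lemma hom_part_esym: "hom_part d (esym i) = (if d = Suc i then esym i else 0)"
  by (auto simp: esym_def hom_part_sum hom_part_monomial exp_deg_sqfree_exp)

lemma hom_part_adjoin_esym:
  assumes "p \<in> adjoin esym (SR_ideal \<Delta>) i"
  shows "hom_part d p \<in> adjoin esym (SR_ideal \<Delta>) i"
  using assms unfolding adjoin_def
proof (rule hom_part_gen_ideal[rotated])
  fix g d assume "g \<in> SR_ideal \<Delta> \<union> esym ` {..<i}"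
  then consider "g \<in> SR_ideal \<Delta>" | j where "j < i" "g = esym j" by blast
  then show "hom_part d g \<in> gen_ideal (SR_ideal \<Delta> \<union> esym ` {..<i})"
  proof cases
    case 1
    then have "hom_part d g \<in> SR_ideal \<Delta>"
      by (auto simp: SR_ideal_def in_keys_iff lookup_hom_part split: if_splits)
    then show ?thesis by (blast intro: gen_ideal_gen)
  next
    case 2
    then show ?thesis by (auto simp: hom_part_esym intro: gen_ideal_gen gen_ideal_zero)
  qed
qed

lemma keys_esym: "Poly_Mapping.keys (esym i) \<subseteq> sqfree_exp ` {A. card A = Suc i}"
  unfolding esym_def using keys_sum[of "\<lambda>A. monomial (sqfree_exp A)" "{A. card A = Suc i}"]
  by (force simp: monomial_def)

text \<open>On the polynomial ring over \<open>U\<close> the last elementary symmetric polynomial is the product of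
  the variables. Each variable is a nonzerodivisor modulo the earlier ones because these are a
  regular sequence after setting the variable to zero.\<close>

lemma weakly_regular_esym_simplex:
  fixes U :: "'v::finite set"
  shows "weakly_regular esym (SR_ideal (Pow U) :: ('v, 'k::field) mpoly set) (card U)"
proof (induction "card U" arbitrary: U)
  case 0
  then show ?case by (simp add: weakly_regular_def)
next
  case (Suc m)
  let ?I = "SR_ideal (Pow U) :: ('v, 'k) mpoly set"
  \<comment> \<open>Killing \<open>x\<close> leaves the simplex on \<open>U - {x}\<close>; the same
    \<open>esym\<close> serve there, since their terms involving other variables lie in its
    ideal.\<close>
  have reg: "weakly_regular esym (insert (Var x) ?I) m" if "x \<in> U" for x
  proof -
    have "{a \<in> Pow U. x \<notin> a} = Pow (U - {x})" by auto
    hence "gen_ideal (insert (Var x) ?I) = gen_ideal (SR_ideal (Pow (U - {x})))"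
      by (simp add: gen_ideal_insert_Var_SR_ideal gen_ideal_SR_ideal down_closed_Pow)
    moreover have "card (U - {x}) = m" using that Suc(2) by simp
    hence "weakly_regular esym (SR_ideal (Pow (U - {x})) :: ('v, 'k) mpoly set) m"
      using Suc(1)[of "U - {x}"] by metis
    ultimately show ?thesis using weakly_regular_cong by blast
  qed
  \<comment> \<open>The simplex is a cone over \<open>x\<close>, so the colon by \<open>x\<close> is
    the ideal itself. The bound \<open>i \<le> m\<close> includes the last index, where the product
    of the variables is cancelled.\<close>
  have Var_reg: "g \<in> adjoin esym ?I i" if "Var x * g \<in> adjoin esym ?I i" "x \<in> U" "i \<le> m" for x g i
  proof -
    have "Var x * h \<in> gen_ideal ?I \<longleftrightarrow> h \<in> gen_ideal ?I" for h
    proof -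
      have "{a. insert x a \<in> Pow U} = Pow U" using \<open>x \<in> U\<close> by auto
      then show ?thesis by (simp add: gen_ideal_SR_ideal down_closed_Pow Var_times_SR_ideal_iff)
    qed
    then show ?thesis using colon_adjoin[OF _ reg[OF \<open>x \<in> U\<close>] \<open>i \<le> m\<close>] that(1) by blast
  qed
  show ?case unfolding weakly_regular_def
  proof (intro allI impI)
    fix i and g :: "('v, 'k) mpoly"
    assume i: "i < card U" and g: "esym i * g \<in> adjoin esym ?I i"
    show "g \<in> adjoin esym ?I i"
    proof (cases "i = m")
      case False
      with i Suc(2) have im: "i < m" by simp
      obtain x where x: "x \<in> U" using i by fastforce
      \<comment> \<open>\<open>N\<close> is the annihilator of \<open>esym i\<close> modulo the
        earlier elements; it lies in \<open>x N\<close> there, so the Nakayama argument kills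
        it.\<close>
      define N where "N = {h. esym i * h \<in> adjoin esym ?I i}"
      have "\<exists>h'\<in>N. h - Var x * h' \<in> adjoin esym ?I i" if "h \<in> N" for h
      proof -
        have "h \<in> adjoin esym (insert (Var x) ?I) i"
          using weakly_regularD[OF reg[OF x] im] that adjoin_subset_insert[of esym ?I i "Var x"]
          unfolding N_def by blast
        then obtain h' where h': "h - Var x * h' \<in> adjoin esym ?I i"
          unfolding adjoin_insert_iff by blast
        have "esym i * h - esym i * (h - Var x * h') \<in> adjoin esym ?I i"
          using that h' unfolding adjoin_def N_def mem_Collect_eq
          by (rule gen_ideal_diff[OF _ gen_ideal_mult])
        hence "Var x * (esym i * h') \<in> adjoin esym ?I i" by (simp add: algebra_simps)
        hence "h' \<in> N" using Var_reg[OF _ x] im unfolding N_def by simp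
        with h' show ?thesis by blast
      qed
      moreover have "g \<in> N" using g by (simp add: N_def)
      ultimately show ?thesis
        using graded_Nakayama[of "?I \<union> esym ` {..<i}" N x g] hom_part_adjoin_esym[of _ "Pow U" i]
        unfolding adjoin_def by blast
    next
      case True
      \<comment> \<open>Any other set of size \<open>card U\<close> leaves \<open>U\<close>, so only
        the product of the variables in \<open>U\<close> survives modulo the ideal.\<close>
      have "esym i - monomial (sqfree_exp U) \<in> ?I"
      proof -
        have "esym i = (monomial (sqfree_exp U) :: ('v, 'k) mpoly)
            + (\<Sum>A \<in> {A. card A = Suc i} - {U}. monomial (sqfree_exp A))"
          unfolding esym_def using Suc(2) True by (intro sum.remove) auto
        moreover have "(\<Sum>A \<in> {A. card A = Suc i} - {U}. monomial (sqfree_exp A)) \<in> gen_ideal ?I"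
        proof (intro gen_ideal_sum gen_ideal_gen)
          fix A assume "A \<in> {A. card A = Suc i} - {U}"
          hence "\<not> A \<subseteq> U" using Suc(2) True by (metis DiffE card_subset_eq finite insertCI mem_Collect_eq)
          then show "monomial (sqfree_exp A) \<in> ?I"
            by (simp add: SR_ideal_def monomial_def keys_sqfree_exp)
        qed
        ultimately show ?thesis by (simp add: gen_ideal_SR_ideal down_closed_Pow)
      qed
      hence "(esym i - monomial (sqfree_exp U)) * g \<in> adjoin esym ?I i"
        unfolding adjoin_def by (intro gen_ideal_mult_right gen_ideal_gen) blast
      hence "esym i * g - (esym i - monomial (sqfree_exp U)) * g \<in> adjoin esym ?I i"
        using g unfolding adjoin_def by (intro gen_ideal_diff)
      hence U: "monomial (sqfree_exp U) * g \<in> adjoin esym ?I i" by (simp add: algebra_simps)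
      have "g \<in> adjoin esym ?I i" if "monomial (sqfree_exp A) * g \<in> adjoin esym ?I i" "A \<subseteq> U" for A
        using finite[of A] that
      proof (induction A)
        case empty
        then show ?case by (simp add: sqfree_exp_def monomial_def)
      next
        case (insert x A)
        hence "Var x * (monomial (sqfree_exp A) * g) \<in> adjoin esym ?I i"
          by (simp add: Var_def sqfree_exp_def monomial_add mult.assoc)
        then show ?case using insert Var_reg True by simp
      qed
      with U show ?thesis by blast
    qed
  qed
qed

text \<open>The sequence is the same on every leaf, which is what
  \<open>weakly_regular_exact\<close> asks for at each branching.\<close>

lemma weakly_regular_esym:
  fixes \<Delta> :: "'v::finite set set"
  assumes "splits t \<Delta>" "down_closed \<Delta>"
  shows "weakly_regular esym (SR_ideal \<Delta> :: ('v, 'k::field) mpoly set) t"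
  using assms
proof induction
  case void
  have "adjoin esym (SR_ideal {} :: ('v, 'k) mpoly set) i = UNIV" for i
    by (auto simp: adjoin_def SR_ideal_def intro: gen_ideal_gen)
  then show ?case by (simp add: weakly_regular_def)
next
  case (simplex U)
  then show ?case using weakly_regular_esym_simplex weakly_regular_mono by blast
next
  case (branch x \<Delta>)
  let ?I = "SR_ideal \<Delta> :: ('v, 'k) mpoly set"
  have "gen_ideal (insert (Var x) ?I) = gen_ideal (SR_ideal {a \<in> \<Delta>. x \<notin> a})"
    by (simp add: gen_ideal_insert_Var_SR_ideal gen_ideal_SR_ideal down_closed_deletion branch.prems)
  hence reg: "weakly_regular esym (insert (Var x) ?I) t"
    using branch.IH(2)[OF down_closed_deletion[OF branch.prems]] weakly_regular_cong by metis
  have colon: "Var x * g \<in> gen_ideal ?I \<longleftrightarrow> g \<in> gen_ideal (SR_ideal {a. insert x a \<in> \<Delta>})" for g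
    by (simp add: gen_ideal_SR_ideal down_closed_star branch.prems Var_times_SR_ideal_iff)
  show ?case
    by (rule weakly_regular_exact[OF colon reg branch.IH(1)[OF down_closed_star[OF branch.prems]]])
qed

text \<open>Unless the ideal is the whole ring, where depth is infinite by convention, all constant
  terms vanish; the final quotient is then nonzero and weak regularity becomes regularity.\<close>

lemma depth_quot_SR_ideal:
  fixes \<Delta> :: "'v::finite set set"
  assumes "splits t \<Delta>" "down_closed \<Delta>"
  shows "enat t \<le> depth_quot (SR_ideal \<Delta> :: ('v, 'k::field) mpoly set)"
proof (cases "SR_ideal \<Delta> = (UNIV :: ('v, 'k) mpoly set)")
  case True
  then show ?thesis by (simp add: depth_quot_def)
next
  case False
  let ?I = "SR_ideal \<Delta> :: ('v, 'k) mpoly set"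
  define fs where "fs = map (esym :: nat \<Rightarrow> ('v, 'k) mpoly) [0..<t]"
  have take: "set (take i fs) = esym ` {..<i}" if "i \<le> t" for i
    using that by (simp add: fs_def take_map take_upt lessThan_atLeast0)
  have "{} \<in> \<Delta>"
  proof (rule ccontr)
    assume "{} \<notin> \<Delta>"
    hence "\<Delta> = {}" using assms(2) by (auto simp: down_closed_def)
    with False show False by (simp add: SR_ideal_def)
  qed
  hence I_max: "?I \<subseteq> SR_ideal {{}}" by (auto simp: SR_ideal_def)
  have max: "max_ideal = (SR_ideal {{}} :: ('v, 'k) mpoly set)"
    by (auto simp: max_ideal_def SR_ideal_def in_keys_iff)
  have fs_max: "set fs \<subseteq> (SR_ideal {{}} :: ('v, 'k) mpoly set)"
  proof -
    have "esym i \<in> (SR_ideal {{}} :: ('v, 'k) mpoly set)" for i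
    proof -
      have "Poly_Mapping.keys a \<noteq> {}" if "a \<in> Poly_Mapping.keys (esym i :: ('v, 'k) mpoly)" for a
      proof -
        obtain A where "a = sqfree_exp A" "card A = Suc i" using keys_esym \<open>a \<in> _\<close> by blast
        then show ?thesis by (auto simp: keys_sqfree_exp simp del: keys_eq_empty)
      qed
      then show ?thesis by (simp add: SR_ideal_def)
    qed
    then show ?thesis by (auto simp: fs_def)
  qed
  have "regular_seq ?I fs"
    unfolding regular_seq_def
  proof (intro conjI allI impI)
    show "set fs \<subseteq> max_ideal" using fs_max max by simp
    have "gen_ideal (?I \<union> set fs) \<subseteq> gen_ideal (SR_ideal {{}})"
      using I_max fs_max by (intro gen_ideal_mono) blast
    also have "\<dots> = SR_ideal {{}}" by (rule gen_ideal_SR_ideal) (auto simp: down_closed_def)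
    finally have "1 \<notin> gen_ideal (?I \<union> set fs)" by (auto simp: SR_ideal_def)
    then show "gen_ideal (?I \<union> set fs) \<noteq> UNIV" by blast
  next
    fix i g
    assume i: "i < length fs" and "fs ! i * g \<in> gen_ideal (?I \<union> set (take i fs))"
    moreover have it: "i < t" using i by (simp add: fs_def)
    ultimately have "esym i * g \<in> adjoin esym ?I i" by (simp add: take adjoin_def) (simp add: fs_def)
    then show "g \<in> gen_ideal (?I \<union> set (take i fs))"
      using weakly_regularD[OF weakly_regular_esym[OF assms] it] it
      by (simp add: take adjoin_def)
  qed
  moreover have "length fs = t" by (simp add: fs_def)
  ultimately have "enat t \<in> {enat (length fs) | fs. regular_seq ?I fs}" by blast
  then show ?thesis using False unfolding depth_quot_def by (simp add: Sup_upper)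
qed

subsection \<open>Stanley decompositions\<close>

text \<open>The exponents of the monomials spanning \<open>u K[Z]\<close>, for
  \<open>d = (u, Z)\<close>.\<close>

definition cell :: "('v \<Rightarrow>\<^sub>0 nat) \<times> 'v set \<Rightarrow> ('v \<Rightarrow>\<^sub>0 nat) set" where
  "cell d = {fst d + b | b. Poly_Mapping.keys b \<subseteq> snd d}"

text \<open>Counting list positions encodes covering, disjointness (repetitions included) and
  avoidance of the ideal at once.\<close>

definition cell_partition :: "'v set set \<Rightarrow> (('v \<Rightarrow>\<^sub>0 nat) \<times> 'v set) list \<Rightarrow> bool" where
  "cell_partition \<Delta> D \<longleftrightarrow>
     (\<forall>a. length (filter (\<lambda>d. a \<in> cell d) D) = (if Poly_Mapping.keys a \<in> \<Delta> then 1 else 0))"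

lemma keys_monomial_times_subset_cell:
  assumes "p \<in> subring_poly (snd d)"
  shows "Poly_Mapping.keys (monomial (fst d) * p) \<subseteq> cell d"
  using assms by (auto simp: keys_monomial_times cell_def subring_poly_def)

text \<open>All summands are spanned by monomials, so the three conditions can be checked on
  exponents.\<close>

lemma cell_partition_imp_stanley_decomp:
  assumes "cell_partition \<Delta> D"
  shows "stanley_decomp (SR_ideal \<Delta> :: ('v, 'k::field) mpoly set) D"
proof -
  have card: "card {i. i < length D \<and> a \<in> cell (D ! i)} = (if Poly_Mapping.keys a \<in> \<Delta> then 1 else 0)"
    for a
    using assms by (simp add: cell_partition_def length_filter_conv_card)
  have face: "Poly_Mapping.keys a \<in> \<Delta>" if "a \<in> cell (D ! i)" "i < length D" for a i
    using card[of a] that by (auto split: if_splits)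
  have cover: "\<exists>i<length D. a \<in> cell (D ! i)" if "Poly_Mapping.keys a \<in> \<Delta>" for a
  proof -
    have "{i. i < length D \<and> a \<in> cell (D ! i)} \<noteq> {}" using card[of a] that by force
    then show ?thesis by blast
  qed
  have disj: "cell (D ! i) \<inter> cell (D ! j) = {}" if "i < length D" "j < length D" "i \<noteq> j" for i j
  proof -
    have "\<not> (a \<in> cell (D ! i) \<and> a \<in> cell (D ! j))" for a
    proof
      assume "a \<in> cell (D ! i) \<and> a \<in> cell (D ! j)"
      hence "{i, j} \<subseteq> {i. i < length D \<and> a \<in> cell (D ! i)}" using that by auto
      hence "card {i, j} \<le> card {i. i < length D \<and> a \<in> cell (D ! i)}" by (intro card_mono) auto
      then show False using that(3) by (simp add: card split: if_splits)
    qed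
    then show ?thesis by blast
  qed
  show ?thesis
    unfolding stanley_decomp_def
  proof (intro conjI allI ballI impI)
    fix i and p :: "('v, 'k) mpoly"
    assume i: "i < length D" and p: "p \<in> subring_poly (snd (D ! i))"
      and I: "monomial (fst (D ! i)) * p \<in> SR_ideal \<Delta>"
    have "Poly_Mapping.keys (monomial (fst (D ! i)) * p) = {}"
      using keys_monomial_times_subset_cell[OF p] face[OF _ i] I
      unfolding SR_ideal_def by blast
    then show "p = 0" by (simp add: keys_monomial_times del: keys_eq_empty) simp
  next
    fix f :: "('v, 'k) mpoly"
    \<comment> \<open>The part of \<open>f\<close> in the cell, divided by the monomial of the cell;
      the subtraction is exact because exponents in the cell are at least
      \<open>fst (D ! i)\<close>.\<close>
    define q where "q i = (\<Sum>a \<in> Poly_Mapping.keys f \<inter> cell (D ! i).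
      Poly_Mapping.single (a - fst (D ! i)) (Poly_Mapping.lookup f a))" for i
    have q: "q i \<in> subring_poly (snd (D ! i))" for i
    proof -
      have "Poly_Mapping.keys (q i) \<subseteq> (\<Union>a \<in> Poly_Mapping.keys f \<inter> cell (D ! i). {a - fst (D ! i)})"
        unfolding q_def using keys_sum by (rule order_trans) (auto split: if_splits)
      moreover have "Poly_Mapping.keys (a - fst (D ! i)) \<subseteq> snd (D ! i)" if "a \<in> cell (D ! i)" for a
        using that by (auto simp: cell_def)
      ultimately show ?thesis unfolding subring_poly_def by blast
    qed
    have mq: "monomial (fst (D ! i)) * q i =
        (\<Sum>a \<in> Poly_Mapping.keys f \<inter> cell (D ! i). Poly_Mapping.single a (Poly_Mapping.lookup f a))" for i
      unfolding q_def sum_distrib_left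
      by (rule sum.cong) (auto simp: monomial_def mult_single cell_def)
    have lq: "Poly_Mapping.lookup (monomial (fst (D ! i)) * q i) a =
        (if a \<in> cell (D ! i) then Poly_Mapping.lookup f a else 0)" for i a
      unfolding mq by (auto simp: lookup_sum lookup_single when_def in_keys_iff)
    have "Poly_Mapping.lookup (\<Sum>i<length D. monomial (fst (D ! i)) * q i) a = Poly_Mapping.lookup f a"
      if a: "Poly_Mapping.keys a \<in> \<Delta>" for a
    proof -
      obtain j where j: "j < length D" "a \<in> cell (D ! j)" using cover[OF a] by blast
      have "(\<Sum>i<length D. if a \<in> cell (D ! i) then Poly_Mapping.lookup f a else 0) =
          (\<Sum>i<length D. if i = j then Poly_Mapping.lookup f a else 0)"
        using j disj by (intro sum.cong) auto
      then show ?thesis using j(1) by (simp add: lookup_sum lq)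
    qed
    hence "f - (\<Sum>i<length D. monomial (fst (D ! i)) * q i) \<in> SR_ideal \<Delta>"
      by (auto simp: SR_ideal_def in_keys_iff lookup_minus)
    then show "\<exists>ps. length ps = length D \<and> (\<forall>i<length D. ps ! i \<in> subring_poly (snd (D ! i))) \<and>
         f - (\<Sum>i<length D. monomial (fst (D ! i)) * ps ! i) \<in> SR_ideal \<Delta>"
      using q by (intro exI[of _ "map q [0..<length D]"]) simp
  next
    fix ps :: "('v, 'k) mpoly list" and i
    assume ps: "\<forall>i<length D. ps ! i \<in> subring_poly (snd (D ! i))"
      and I: "(\<Sum>i<length D. monomial (fst (D ! i)) * ps ! i) \<in> SR_ideal \<Delta>" and i: "i < length D"
    let ?m = "\<lambda>j. monomial (fst (D ! j)) * ps ! j"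
    have sub: "Poly_Mapping.keys (?m j) \<subseteq> cell (D ! j)" if "j < length D" for j
      using keys_monomial_times_subset_cell ps that by blast
    have "a \<in> Poly_Mapping.keys (\<Sum>j<length D. ?m j)" if a: "a \<in> Poly_Mapping.keys (?m i)" for a
    proof -
      \<comment> \<open>Cells are disjoint, so no other summand can cancel a term of this
        one.\<close>
      have "Poly_Mapping.lookup (?m j) a = 0" if "j < length D" "j \<noteq> i" for j
        using sub[OF i] sub[OF that(1)] disj[OF that(1) i that(2)] a
        by (meson disjoint_iff not_in_keys_iff_lookup_eq_zero subsetD)
      hence "(\<Sum>j<length D. Poly_Mapping.lookup (?m j) a) =
          (\<Sum>j<length D. if j = i then Poly_Mapping.lookup (?m i) a else 0)"
        by (intro sum.cong) auto
      then show ?thesis using a i by (simp add: in_keys_iff lookup_sum)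
    qed
    then show "?m i \<in> SR_ideal \<Delta>" using I by (auto simp: SR_ideal_def)
  qed
qed

text \<open>Surviving monomials divisible by \<open>x\<close> are \<open>x\<close> times those
  surviving in the star, and the others belong to the deletion; so shift the first partition by
  \<open>x\<close> and append the second.\<close>

lemma splits_imp_cell_partition:
  assumes "splits t \<Delta>"
  shows "\<exists>D. cell_partition \<Delta> D \<and> (\<forall>d\<in>set D. t \<le> card (snd d))"
  using assms
proof induction
  case void
  show ?case by (rule exI[of _ "[]"]) (simp add: cell_partition_def)
next
  case (simplex U)
  then show ?case
    by (intro exI[of _ "[(0, U)]"]) (simp add: cell_partition_def cell_def)
next
  case (branch x \<Delta>)
  then obtain D1 D2 where D: "cell_partition {a. insert x a \<in> \<Delta>} D1"
      "cell_partition {a \<in> \<Delta>. x \<notin> a} D2"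
    and card: "\<forall>d\<in>set D1. t \<le> card (snd d)" "\<forall>d\<in>set D2. t \<le> card (snd d)"
    by blast
  let ?s = "Poly_Mapping.single x (1::nat)"
  define g where "g d = (?s + fst d, snd d)" for d :: "('a \<Rightarrow>\<^sub>0 nat) \<times> 'a set"
  have ks: "Poly_Mapping.keys (?s + b) = insert x (Poly_Mapping.keys b)" for b
    by (simp add: keys_plus_nat)
  have "cell_partition \<Delta> (map g D1 @ D2)"
    unfolding cell_partition_def
  proof
    fix a
    have D1: "length (filter (\<lambda>d. b \<in> cell d) D1) = (if insert x (Poly_Mapping.keys b) \<in> \<Delta> then 1 else 0)"
      and D2: "length (filter (\<lambda>d. b \<in> cell d) D2) =
        (if Poly_Mapping.keys b \<in> \<Delta> \<and> x \<notin> Poly_Mapping.keys b then 1 else 0)" for b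
      using D by (simp_all add: cell_partition_def)
    have cell_g: "c \<in> cell (g d) \<longleftrightarrow> (\<exists>b. c = ?s + b \<and> b \<in> cell d)" for c d
      by (auto simp: cell_def g_def add.assoc)
    \<comment> \<open>Shifted cells contain only exponents with \<open>x\<close> in the support, the
      second list only those without, so one list contributes in each case.\<close>
    show "length (filter (\<lambda>d. a \<in> cell d) (map g D1 @ D2)) =
        (if Poly_Mapping.keys a \<in> \<Delta> then 1 else 0)"
    proof (cases "x \<in> Poly_Mapping.keys a")
      case True
      then obtain b where b: "a = ?s + b" by (rule exp_split)
      have "a \<in> cell (g d) \<longleftrightarrow> b \<in> cell d" for d
        by (simp add: cell_g b)
      moreover have "Poly_Mapping.keys a = insert x (Poly_Mapping.keys b)"
        unfolding b by (rule ks)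
      ultimately show ?thesis by (simp add: filter_map o_def D1 D2)
    next
      case False
      hence "a \<notin> cell (g d)" for d using ks unfolding cell_g by auto
      then show ?thesis using False by (simp add: filter_map o_def D2)
    qed
  qed
  moreover have "\<forall>d\<in>set (map g D1 @ D2). t \<le> card (snd d)"
    using card by (auto simp: g_def)
  ultimately show ?case by blast
qed

lemma sdepth_quot_SR_ideal:
  assumes "splits t \<Delta>"
  shows "enat t \<le> sdepth_quot (SR_ideal \<Delta> :: ('v, 'k::field) mpoly set)"
proof -
  obtain D where D: "cell_partition \<Delta> D" "\<forall>d\<in>set D. t \<le> card (snd d)"
    using splits_imp_cell_partition[OF assms] by blast
  \<comment> \<open>The empty list, which arises for the zero module, has Stanley depth
    infinity.\<close>
  have "enat t \<le> stanley_depth_of D"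
    using D(2) by (auto simp: stanley_depth_of_def)
  also have "\<dots> \<le> sdepth_quot (SR_ideal \<Delta> :: ('v, 'k) mpoly set)"
    unfolding sdepth_quot_def using cell_partition_imp_stanley_decomp[OF D(1)]
    by (intro Sup_upper) blast
  finally show ?thesis .
qed

section \<open>The bound for edge ideals of clutters\<close>

theorem theorem3p7:
  fixes V :: "'v::finite set" and E :: "'v set set"
  assumes "clutter V E"
  shows "min (depth_quot (edge_ideal E :: ('v, 'k::field) mpoly set))
             (sdepth_quot (edge_ideal E :: ('v, 'k) mpoly set))
         \<ge> enat (edgewise_domination_index E + card (UNIV :: 'v set) - card (red_vertices E))"
proof -
  have "splits (edgewise_domination_index E + card (UNIV :: 'v set) - card (red_vertices E)) (faces E)"
    unfolding red_vertices_def using assms by (intro splits_faces) (simp add: clutter_def)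
  moreover have "down_closed (faces E)" by (auto simp: down_closed_def faces_def)
  ultimately show ?thesis
    by (simp add: edge_ideal_eq_SR_ideal depth_quot_SR_ideal sdepth_quot_SR_ideal)
qed

end
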